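(* Let $p\ge 1$, let $k$ be a positive integer and let $P_1,\ldots,P_L$ be polygonal curves in $\mathbb{R}^2$, each with at most $n$ vertices. Suppose the simplification algorithm used takes $T(n)$ time on a curve with $n$ vertices, and the $p$-mean curve algorithm used takes $G(L,n)$ time on $L$ curves each with complexity (number of vertices) at most $n$. Then the $p$-Mean Algorithm for the continuous $p$-mean curve takes $O(L\,T(n)+G(L,k))$ time.
   Context: A polygonal curve $P$ is a finite sequence of points in $\mathbb{R}^2$ together with the segments connecting consecutive points, regarded as a continuous map $[0,1]\to\mathbb{R}^2$. The Fréchet distance is $d_F(P,Q)=\inf_{\gamma,\delta}\max_{t\in[0,1]} \|P(\gamma(t))-Q(\delta(t))\|_2$, over continuous non-decreasing bijections $\gamma,\delta:[0,1]\to[0,1]$. A (continuous) $p$-mean curve ($p$-MC) of polygonal curves $Q_1,\ldots,Q_L$ is a polygonal curve with at most $k$ vertices (arbitrary points of the plane) that minimizes $\left(\sum_{i=1}^L d_F(\cdot,Q_i)^p\right)^{1/p}$ among all polygonal curves with at most $k$ vertices. An $\alpha$-approximation min-$\epsilon$ simplification algorithm returns, for a polygonal curve $P$, a polygonal curve $P'$ with at most $k$ vertices such that $d_F(P,P')\le\alpha\cdot d_F(P,S)$ for every polygonal curve $S$ with at most $k$ vertices. $p$-Mean Algorithm: (1) for each $i=1,\ldots,L$ compute $P'_i$, the output of an $\alpha$-approximation min-$\epsilon$ simplification algorithm on $P_i$ (so $P'_i$ has at most $k$ vertices); (2) output $M'$, a $p$-MC (with at most $k$ vertices) of $P'_1,\ldots,P'_L$,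 computed by the given $p$-MC algorithm. *)

theory Defs
  imports "HOL-Analysis.Analysis"
begin

subsection \<open>Polygonal curves and the Frechet distance\<close>

typedef polygonal_curve = "{vs :: (real^2) list. vs \<noteq> []}"
  morphisms vertices Polygonal_Curve
  by (rule exI[of _ "[0]"]) simp

definition n_vertices :: "polygonal_curve \<Rightarrow> nat" where
  "n_vertices P = length (vertices P)"

text \<open>The segments are concatenated with the library's \<open>+++\<close>, so segment lengths in the parameter
  interval are dyadic rather than uniform. The Frechet distance does not depend on this choice.
  The equation for the empty list is never used, as a polygonal curve has at least one vertex.\<close>

fun polygonal_path :: "(real^2) list \<Rightarrow> real \<Rightarrow> real^2" where
  "polygonal_path [] = (\<lambda>_. 0)"
| "polygonal_path [v] = linepath v v"
| "polygonal_path [v, w] = linepath v w"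
| "polygonal_path (v # w # u # vs) = linepath v w +++ polygonal_path (w # u # vs)"

definition curve_map :: "polygonal_curve \<Rightarrow> real \<Rightarrow> real^2" where
  "curve_map P = polygonal_path (vertices P)"

definition reparametrization :: "(real \<Rightarrow> real) \<Rightarrow> bool" where
  "reparametrization \<gamma> \<longleftrightarrow>
     continuous_on {0..1} \<gamma> \<and> mono_on {0..1} \<gamma> \<and> bij_betw \<gamma> {0..1} {0..1}"

text \<open>The supremum is a maximum, since a continuous function on a compact interval is involved.\<close>

definition frechet_dist :: "polygonal_curve \<Rightarrow> polygonal_curve \<Rightarrow> real" where
  "frechet_dist P Q =
     Inf {(SUP t\<in>{0..1}. norm (curve_map P (\<gamma> t) - curve_map Q (\<delta> t))) | \<gamma> \<delta>.
            reparametrization \<gamma> \<and> reparametrization \<delta>}"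

subsection \<open>Mean curves and simplifications\<close>

definition mean_cost :: "real \<Rightarrow> polygonal_curve list \<Rightarrow> polygonal_curve \<Rightarrow> real" where
  "mean_cost p Qs M = (\<Sum>i<length Qs. frechet_dist M (Qs ! i) powr p) powr (1 / p)"

definition is_mean_curve ::
  "real \<Rightarrow> nat \<Rightarrow> polygonal_curve list \<Rightarrow> polygonal_curve \<Rightarrow> bool" where
  "is_mean_curve p k Qs M \<longleftrightarrow>
     n_vertices M \<le> k \<and> (\<forall>S. n_vertices S \<le> k \<longrightarrow> mean_cost p Qs M \<le> mean_cost p Qs S)"

definition is_simplification ::
  "real \<Rightarrow> nat \<Rightarrow> polygonal_curve \<Rightarrow> polygonal_curve \<Rightarrow> bool" where
  "is_simplification \<alpha> k P P' \<longleftrightarrow>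
     n_vertices P' \<le> k \<and>
     (\<forall>S. n_vertices S \<le> k \<longrightarrow> frechet_dist P P' \<le> \<alpha> * frechet_dist P S)"

subsection \<open>Algorithms and running time\<close>

text \<open>An algorithm is a deterministic machine: an input is loaded into an initial state, and each
  step either moves to a new state (\<open>Inl\<close>) or halts with an output (\<open>Inr\<close>). Running time is the
  number of steps, the halting step included. What a given machine may do in one step is left
  open, so that no particular set of instructions (such as field operations and comparisons of
  reals) is imposed on the given simplification and mean curve algorithms.\<close>

record ('a, 's, 'b) algorithm =
  init :: "'a \<Rightarrow> 's"
  step :: "'s \<Rightarrow> 's + 'b"

inductive halts :: "('s \<Rightarrow> 's + 'b) \<Rightarrow> 's \<Rightarrow> 'b \<Rightarrow> nat \<Rightarrow> bool" for f where
  halt: "f s = Inr y \<Longrightarrow> halts f s y 1"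
| continue: "f s = Inl s' \<Longrightarrow> halts f s' y t \<Longrightarrow> halts f s y (Suc t)"

definition exec :: "('a, 's, 'b) algorithm \<Rightarrow> 'a \<Rightarrow> 'b \<Rightarrow> nat \<Rightarrow> bool" where
  "exec A x y t \<longleftrightarrow> halts (step A) (init A x) y t"

definition takes_time :: "('a, 's, 'b) algorithm \<Rightarrow> 'a \<Rightarrow> real \<Rightarrow> bool" where
  "takes_time A x \<tau> \<longleftrightarrow> (\<exists>y t. exec A x y t \<and> real t \<le> \<tau>)"

definition simplification_algorithm ::
  "real \<Rightarrow> nat \<Rightarrow> (polygonal_curve, 's, polygonal_curve) algorithm \<Rightarrow> bool" where
  "simplification_algorithm \<alpha> k A \<longleftrightarrow>
     (\<forall>P. \<exists>P' t. exec A P P' t \<and> is_simplification \<alpha> k P P')"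

definition mean_curve_algorithm ::
  "real \<Rightarrow> nat \<Rightarrow> (polygonal_curve list, 'm, polygonal_curve) algorithm \<Rightarrow> bool" where
  "mean_curve_algorithm p k B \<longleftrightarrow>
     (\<forall>Qs. Qs \<noteq> [] \<longrightarrow> (\<exists>M t. exec B Qs M t \<and> is_mean_curve p k Qs M))"

subsection \<open>The p-Mean Algorithm\<close>

text \<open>The list in the state is an array of references to curves, overwritten in place: entries
  below the loop index are already simplified. A step of the machine is either one step of the
  subroutine being executed (its halting step also stores the result and increments the index), or
  one loop test together with the call of a subroutine on curves passed by reference.\<close>

datatype ('s, 'm) p_mean_state =
    Loop nat "polygonal_curve list"
  | Simplify nat "polygonal_curve list" 's
  | Mean 'm

fun p_mean_step ::
  "(polygonal_curve, 's, polygonal_curve) algorithm \<Rightarrow>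
   (polygonal_curve list, 'm, polygonal_curve) algorithm \<Rightarrow>
   ('s, 'm) p_mean_state \<Rightarrow> ('s, 'm) p_mean_state + polygonal_curve" where
  "p_mean_step A B (Loop i Qs) =
     Inl (if i < length Qs then Simplify i Qs (init A (Qs ! i)) else Mean (init B Qs))"
| "p_mean_step A B (Simplify i Qs s) =
     (case step A s of
        Inl s' \<Rightarrow> Inl (Simplify i Qs s')
      | Inr P' \<Rightarrow> Inl (Loop (Suc i) (Qs[i := P'])))"
| "p_mean_step A B (Mean m) =
     (case step B m of
        Inl m' \<Rightarrow> Inl (Mean m')
      | Inr M' \<Rightarrow> Inr M')"

definition p_mean_algorithm ::
  "(polygonal_curve, 's, polygonal_curve) algorithm \<Rightarrow>
   (polygonal_curve list, 'm, polygonal_curve) algorithm \<Rightarrow>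
   (polygonal_curve list, ('s, 'm) p_mean_state, polygonal_curve) algorithm" where
  "p_mean_algorithm A B = \<lparr>init = Loop 0, step = p_mean_step A B\<rparr>"

end

theory Submission imports Defs begin

text \<open>The machine makes one step per loop test or call and otherwise simulates the subroutines step
  by step. Determinism guarantees that the simplification output produced within \<open>T n\<close> steps is
  the one with at most \<open>k\<close> vertices, so the mean curve subroutine costs at most \<open>G L k\<close>. Every run
  has at least one step, so the \<open>L + 1\<close> extra steps at most double the cost.\<close>

lemma halts_deterministic:
  assumes "halts f s y t" and "halts f s y' t'"
  shows "y = y' \<and> t = t'"
  using assms
proof (induction arbitrary: y' t')
  case (halt s y)
  from halt(2,1) show ?case by cases auto
next
  case (continue s s' y t)
  from continue.prems continue.hyps(1) obtain u where "halts f s' y' u" "t' = Suc u"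
    by cases auto
  with continue.IH show ?case by blast
qed

lemma halts_ge_1: "halts f s y t \<Longrightarrow> t \<ge> 1"
  by (induction rule: halts.induct) auto

text \<open>Lets the loop overhead be absorbed into the bounds of the subroutines.\<close>

lemma takes_time_ge_1: "takes_time A x \<tau> \<Longrightarrow> \<tau> \<ge> 1"
  unfolding takes_time_def exec_def using halts_ge_1 by force

lemma simplification_algorithm_exec:
  assumes "simplification_algorithm \<alpha> k A" and "takes_time A P \<tau>"
  obtains P' t where "exec A P P' t" "real t \<le> \<tau>" "n_vertices P' \<le> k"
  using assms unfolding simplification_algorithm_def is_simplification_def takes_time_def exec_def
  by (metis halts_deterministic)

lemma halts_Mean:
  "halts (step B) m y t \<Longrightarrow> halts (p_mean_step A B) (Mean m) y t"
  \<comment> \<open>The simplifier turns the step count \<open>1\<close> into \<open>Suc 0\<close>,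
    so \<open>halts.halt\<close> is brought to the same form.\<close>
  by (induction rule: halts.induct) (auto intro: halts.continue halts.halt[simplified])

text \<open>The halting step of \<open>A\<close> is itself the step that stores \<open>P'\<close>
  and returns to the loop, so the call adds exactly \<open>t\<close> steps to the rest of the
  run.\<close>

lemma halts_Simplify:
  assumes "halts (step A) s P' t"
    and "halts (p_mean_step A B) (Loop (Suc i) (Qs[i := P'])) y u"
  shows "halts (p_mean_step A B) (Simplify i Qs s) y (t + u)"
  using assms by (induction rule: halts.induct) (auto intro: halts.continue)

text \<open>Loop invariant: entries below \<open>i\<close> are simplified, the others still have
  their original size bound. Each remaining entry costs one loop test plus a run of
  \<open>A\<close>; the final \<open>1 + g\<close> pays for the failing test and the run of
  \<open>B\<close>.\<close>

lemma halts_Loop: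
  assumes A: "simplification_algorithm \<alpha> k A"
    and T: "\<And>P. n_vertices P \<le> n \<Longrightarrow> takes_time A P \<tau>"
    and G: "\<And>Rs. length Rs = length Qs \<Longrightarrow> \<forall>R\<in>set Rs. n_vertices R \<le> k \<Longrightarrow> takes_time B Rs g"
    and "i \<le> length Qs"
    and "\<forall>j<i. n_vertices (Qs ! j) \<le> k"
    and "\<forall>j<length Qs. i \<le> j \<longrightarrow> n_vertices (Qs ! j) \<le> n"
  shows "\<exists>y u. halts (p_mean_step A B) (Loop i Qs) y u \<and>
    real u \<le> real (length Qs - i) * (1 + \<tau>) + 1 + g"
  \<comment> \<open>\<open>G\<close> enters the induction too: it mentions \<open>Qs\<close>, which
    changes from one iteration to the next.\<close>
  using assms(3-)
proof (induction "length Qs - i" arbitrary: i Qs)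
  case 0
  then have i: "i = length Qs" by simp
  with 0 have "\<forall>R\<in>set Qs. n_vertices R \<le> k"
    by (simp add: all_set_conv_all_nth)
  with 0 have "takes_time B Qs g"
    by blast
  then obtain y t where "halts (step B) (init B Qs) y t" "real t \<le> g"
    unfolding takes_time_def exec_def by blast
  then show ?case using i
    by (intro exI[of _ y] exI[of _ "Suc t"]) (auto intro: halts.continue halts_Mean)
next
  case (Suc d)
  then have i: "i < length Qs" by simp
  with Suc.prems T have "takes_time A (Qs ! i) \<tau>" by blast
  then obtain P' t where P': "halts (step A) (init A (Qs ! i)) P' t" "real t \<le> \<tau>" "n_vertices P' \<le> k"
    using simplification_algorithm_exec[OF A] unfolding exec_def by metis
  let ?Rs = "Qs[i := P']"
  have "\<exists>y u. halts (p_mean_step A B) (Loop (Suc i) ?Rs) y u \<and>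
      real u \<le> real (length ?Rs - Suc i) * (1 + \<tau>) + 1 + g"
    using Suc.prems Suc.hyps(2) P'(3)
    \<comment> \<open>Storing \<open>P'\<close> at \<open>i\<close> extends the simplified prefix by
      one and leaves the length and the later entries alone.\<close>
    by (intro Suc.hyps(1)) (auto simp: nth_list_update less_Suc_eq)
  then obtain y u where "halts (p_mean_step A B) (Loop (Suc i) ?Rs) y u"
      "real u \<le> real (length ?Rs - Suc i) * (1 + \<tau>) + 1 + g"
    by blast
  moreover have "length ?Rs - Suc i = d"
    using Suc.hyps(2) by simp
  ultimately have u: "halts (p_mean_step A B) (Loop (Suc i) ?Rs) y u"
      "real u \<le> real d * (1 + \<tau>) + 1 + g"
    by simp_all
  \<comment> \<open>One step for the loop test, \<open>t\<close> for \<open>A\<close>,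
    \<open>u\<close> for the remaining iterations and \<open>B\<close>.\<close>
  have "halts (p_mean_step A B) (Loop i Qs) y (Suc (t + u))"
    using halts_Simplify[OF P'(1) u(1)] i by (auto intro: halts.continue)
  moreover have "real (Suc (t + u)) \<le> real (length Qs - i) * (1 + \<tau>) + 1 + g"
    using u(2) P'(2) by (simp flip: Suc.hyps(2) add: algebra_simps)
  ultimately show ?case by blast
qed

lemma p_mean_algorithm_takes_time:
  assumes "simplification_algorithm \<alpha> k A"
    and T: "\<And>P. n_vertices P \<le> n \<Longrightarrow> takes_time A P \<tau>"
    and G: "\<And>Qs. length Qs = length Ps \<Longrightarrow> \<forall>Q\<in>set Qs. n_vertices Q \<le> k \<Longrightarrow> takes_time B Qs g"
    and "\<forall>P\<in>set Ps. n_vertices P \<le> n"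
  shows "takes_time (p_mean_algorithm A B) Ps (real (length Ps) * (1 + \<tau>) + 1 + g)"
proof -
  have "\<exists>y u. halts (p_mean_step A B) (Loop 0 Ps) y u \<and>
      real u \<le> real (length Ps - 0) * (1 + \<tau>) + 1 + g"
    using assms(4) by (intro halts_Loop[OF assms(1) T G]) auto
  then show ?thesis
    by (simp add: takes_time_def exec_def p_mean_algorithm_def)
qed

theorem theorem4:
  "\<exists>C > 0. \<forall>(p :: real) (k :: nat) (\<alpha> :: real)
      (A :: (polygonal_curve, 's, polygonal_curve) algorithm)
      (B :: (polygonal_curve list, 'm, polygonal_curve) algorithm)
      (T :: nat \<Rightarrow> real) (G :: nat \<Rightarrow> nat \<Rightarrow> real).
    p \<ge> 1 \<and> k \<ge> 1 \<and>
    simplification_algorithm \<alpha> k A \<and>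
    mean_curve_algorithm p k B \<and>
    (\<forall>n P. n_vertices P \<le> n \<longrightarrow> takes_time A P (T n)) \<and>
    (\<forall>L n Qs. L \<ge> 1 \<and> length Qs = L \<and> (\<forall>Q\<in>set Qs. n_vertices Q \<le> n) \<longrightarrow>
       takes_time B Qs (G L n)) \<longrightarrow>
    (\<forall>L n Ps. L \<ge> 1 \<and> length Ps = L \<and> (\<forall>P\<in>set Ps. n_vertices P \<le> n) \<longrightarrow>
       takes_time (p_mean_algorithm A B) Ps (C * (real L * T n + G L k)))"
proof (intro exI[of _ "2::real"] conjI allI impI)
  fix p :: real and k :: nat and \<alpha> :: real
    and A :: "(polygonal_curve, 's, polygonal_curve) algorithm"
    and B :: "(polygonal_curve list, 'm, polygonal_curve) algorithm"
    and T :: "nat \<Rightarrow> real" and G :: "nat \<Rightarrow> nat \<Rightarrow> real"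
    and L n :: nat and Ps :: "polygonal_curve list"
  assume hyps: "p \<ge> 1 \<and> k \<ge> 1 \<and> simplification_algorithm \<alpha> k A \<and> mean_curve_algorithm p k B \<and>
      (\<forall>n P. n_vertices P \<le> n \<longrightarrow> takes_time A P (T n)) \<and>
      (\<forall>L n Qs. L \<ge> 1 \<and> length Qs = L \<and> (\<forall>Q\<in>set Qs. n_vertices Q \<le> n) \<longrightarrow>
         takes_time B Qs (G L n))"
    and Ps: "L \<ge> 1 \<and> length Ps = L \<and> (\<forall>P\<in>set Ps. n_vertices P \<le> n)"
  have G: "takes_time B Qs (G L k)" if "length Qs = L" "\<forall>Q\<in>set Qs. n_vertices Q \<le> k" for Qs
    using hyps Ps that by blast
  have time: "takes_time (p_mean_algorithm A B) Ps (real L * (1 + T n) + 1 + G L k)"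
    using p_mean_algorithm_takes_time[of \<alpha> k A n "T n" Ps B "G L k"] hyps Ps G by blast
  \<comment> \<open>A lower bound on \<open>T n\<close> needs an actual input;
    \<open>L \<ge> 1\<close> supplies one.\<close>
  have "hd Ps \<in> set Ps" using Ps by (intro hd_in_set) auto
  with hyps Ps have "takes_time A (hd Ps) (T n)" by blast
  then have "T n \<ge> 1" by (rule takes_time_ge_1)
  then have "real L * 1 \<le> real L * T n" by (intro mult_left_mono) auto
  \<comment> \<open>Likewise for \<open>G L k\<close>: copies of any simplification output form an
    admissible input of length \<open>L\<close>.\<close>
  moreover obtain P' where "n_vertices P' \<le> k"
    using hyps unfolding simplification_algorithm_def is_simplification_def by blast
  then have "takes_time B (replicate L P') (G L k)" by (intro G) auto
  then have "G L k \<ge> 1" by (rule takes_time_ge_1)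
  \<comment> \<open>The overhead \<open>L\<close> is at most \<open>L * T n\<close>, and the extra
    \<open>1\<close> at most \<open>G L k\<close>.\<close>
  ultimately have "real L * (1 + T n) + 1 + G L k \<le> 2 * (real L * T n + G L k)"
    by (simp add: algebra_simps)
  with time show "takes_time (p_mean_algorithm A B) Ps (2 * (real L * T n + G L k))"
    unfolding takes_time_def by (meson order_trans)
qed simp

end
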